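(* Let $E=(E^0,E^1,r,s)$ be a finite directed graph such that there is a $v\in E^0$ with $r(e)=s(e)=v$ for any $e\in E^1$. Let $G$ be a second countable locally compact abelian group with dual $\Gamma$, and let $\omega$ be a labelling map from $E^*$ to $\Gamma$. Then $-\omega_e\notin\overline{\omega(E^* )}$ for every $e\in E^1$ if and only if $\omega$ is almost proper.
   Context: A directed graph $E=(E^0,E^1,r,s)$ has vertex set $E^0$, edge set $E^1$ and range and source maps $r,s:E^1\to E^0$; it is finite if $E^0$ and $E^1$ are finite. $E^n$ is the set of paths $\mu=e_1\cdots e_n$ of length $n$ (with $r(e_i)=s(e_{i+1})$); vertices are paths of length $0$; $E^*=\bigcup_{n\ge0}E^n$. A labelling map is a map $\omega:E^*\to\Gamma$, $\mu\mapsto\omega_\mu$, with $\omega_{e_1\cdots e_n}=\omega_{e_1}+\cdots+\omega_{e_n}$ and $\omega_v=1_\Gamma$ for $v\in E^0$, where $1_\Gamma$ is the unit of the (additively written) group $\Gamma$. It is almost proper if $\omega^{-1}(A)\setminus E^0$ is a finite set for every compact subset $A$ of $\Gamma$. The bar denotes closure in $\Gamma$. *)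

theory Defs
  imports "HOL-Analysis.Analysis" "Graph_Theory.Arc_Walk"
begin

section \<open>The dual of a topological abelian group\<close>

text \<open>
  The group is written additively; its characters are the continuous homomorphisms into the
  unit circle of the complex plane.
\<close>

definition is_character :: "('g::topological_ab_group_add \<Rightarrow> complex) \<Rightarrow> bool" where
  "is_character \<phi> \<longleftrightarrow>
     continuous_on UNIV \<phi> \<and> (\<forall>x. norm (\<phi> x) = 1) \<and> (\<forall>x y. \<phi> (x + y) = \<phi> x * \<phi> y)"

typedef (overloaded) 'g dual =
  "{\<phi> :: 'g::topological_ab_group_add \<Rightarrow> complex. is_character \<phi>}"
  morphisms dual_app Abs_dual
  by (rule exI[of _ "\<lambda>_. 1"]) (simp add: is_character_def)

setup_lifting type_definition_dual

text \<open>The group operation is pointwise multiplication of characters, written additively.\<close>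

instantiation dual :: (topological_ab_group_add) ab_group_add
begin

lift_definition zero_dual :: "'a dual" is "\<lambda>_. 1"
  by (simp add: is_character_def)

lift_definition plus_dual :: "'a dual \<Rightarrow> 'a dual \<Rightarrow> 'a dual" is "\<lambda>\<phi> \<psi> x. \<phi> x * \<psi> x"
  by (auto simp: is_character_def norm_mult intro!: continuous_intros)

lift_definition uminus_dual :: "'a dual \<Rightarrow> 'a dual" is "\<lambda>\<phi> x. inverse (\<phi> x)"
  by (auto simp: is_character_def norm_inverse intro!: continuous_intros)
     (metis norm_zero zero_neq_one)

definition minus_dual :: "'a dual \<Rightarrow> 'a dual \<Rightarrow> 'a dual" where
  "minus_dual \<phi> \<psi> = \<phi> + - \<psi>"

instance
proof
  fix a b c :: "'a dual"
  show "a + b + c = a + (b + c)" by transfer (simp add: mult.assoc)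
  show "a + b = b + a" by transfer (simp add: mult.commute)
  show "0 + a = a" by transfer simp
  show "- a + a = 0"
    by transfer (auto simp: is_character_def fun_eq_iff, metis left_inverse norm_zero zero_neq_one)
  show "a - b = a + - b" by (rule minus_dual_def)
qed

end

text \<open>The compact-open topology.\<close>

instantiation dual :: (topological_ab_group_add) topological_space
begin

definition open_dual :: "'a dual set \<Rightarrow> bool" where
  "open_dual = generate_topology
     {{\<phi>. dual_app \<phi> ` K \<subseteq> U} | K U. compact K \<and> open U}"

instance
  by standard (auto simp: open_dual_def intro: generate_topology.intros)

end


section \<open>Paths and labelling maps\<close>

text \<open>
  Source and range of an edge are \<^const>\<open>tail\<close> and \<^const>\<open>head\<close>. A path is a
  pair of its source and its list of edges, so that paths of length \<open>0\<close> are the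
  pairs \<open>(v, [])\<close>, one for each vertex \<open>v\<close>.
\<close>

definition paths_of_length ::
    "('v, 'e) pre_digraph \<Rightarrow> nat \<Rightarrow> ('v \<times> 'e list) set" where
  "paths_of_length E n = {(u, p). length p = n \<and> (\<exists>v. pre_digraph.awalk E u p v)}"

definition paths :: "('v, 'e) pre_digraph \<Rightarrow> ('v \<times> 'e list) set" where
  "paths E = (\<Union>n. paths_of_length E n)"

definition edge_path :: "('v, 'e) pre_digraph \<Rightarrow> 'e \<Rightarrow> 'v \<times> 'e list" where
  "edge_path E e = (tail E e, [e])"

text \<open>Only the values of a labelling map on \<^const>\<open>paths\<close> are meaningful.\<close>

definition labelling_map ::
    "('v, 'e) pre_digraph \<Rightarrow> ('v \<times> 'e list \<Rightarrow> 'a::ab_group_add) \<Rightarrow> bool" where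
  "labelling_map E \<omega> \<longleftrightarrow>
     (\<forall>v\<in>verts E. \<omega> (v, []) = 0) \<and>
     (\<forall>(u, p)\<in>paths E. p \<noteq> [] \<longrightarrow> \<omega> (u, p) = (\<Sum>e\<leftarrow>p. \<omega> (edge_path E e)))"

definition almost_proper ::
    "('v, 'e) pre_digraph \<Rightarrow> ('v \<times> 'e list \<Rightarrow> 'a::topological_space) \<Rightarrow> bool" where
  "almost_proper E \<omega> \<longleftrightarrow>
     (\<forall>A. compact A \<longrightarrow> finite ({\<mu> \<in> paths E. \<omega> \<mu> \<in> A} - paths_of_length E 0))"

end

theory Submission
  imports Defs
begin

text \<open>
  All edges are loops at one vertex, so the label of a path depends only on the multiset of its
  edges, and the labels form a finitely generated submonoid \<open>S\<close> of \<open>\<Gamma>\<close>.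

  If infinitely many paths had labels in a compact set \<open>A\<close>, then by Dickson's lemma there would
  be an infinite increasing sequence of multisets with labels \<open>x\<^sub>n\<close> in \<open>A\<close>. By compactness some
  difference \<open>x\<^sub>j - x\<^sub>i\<close> with \<open>i < j\<close> is close to \<open>0\<close>, and if \<open>e\<close> is an edge that occurs more often
  in the \<open>j\<close>th multiset, then \<open>x\<^sub>j - x\<^sub>i - \<omega>\<^sub>e\<close> is an element of \<open>S\<close> close to \<open>-\<omega>\<^sub>e\<close>.

  Conversely, let \<open>-\<omega>\<^sub>e\<close> be in the closure of \<open>S\<close>. As \<open>G\<close> is exhausted by countably many compact
  sets, \<open>\<Gamma>\<close> is first countable, so some sequence of labels converges to \<open>-\<omega>\<^sub>e\<close>. The sequence
  together with its limit is compact, so almost properness makes \<open>-\<omega>\<^sub>e\<close> itself the label of a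
  path \<open>\<mu>\<close>, and all the powers of \<open>e\<mu>\<close> have label \<open>0\<close>.
\<close>

section \<open>Dickson's lemma for multisets\<close>

text \<open>Some subsequence is monotone; if it decreases, well-ordering of the natural numbers
  makes it constant from the point where it attains its minimum.\<close>

lemma incseq_subseq_nat:
  fixes s :: "nat \<Rightarrow> nat"
  obtains r :: "nat \<Rightarrow> nat" where "strict_mono r" "incseq (s \<circ> r)"
proof -
  obtain f where f: "strict_mono f" "monoseq (\<lambda>n. s (f n))"
    using seq_monosub by blast
  show thesis
  proof (cases "incseq (\<lambda>n. s (f n))")
    case True
    then show thesis using that[of f] f by (simp add: o_def)
  next
    case False
    then have dec: "decseq (\<lambda>n. s (f n))" using f by (simp add: monoseq_iff)
    define m where "m = (LEAST m. \<exists>n. s (f n) = m)"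
    obtain n where n: "s (f n) = m"
      using LeastI_ex[of "\<lambda>m. \<exists>n. s (f n) = m"] unfolding m_def by blast
    have "m \<le> s (f k)" for k
      unfolding m_def by (rule Least_le) blast
    moreover have "s (f (n + k)) \<le> m" for k
      using decseqD[OF dec, of n "n + k"] n by simp
    ultimately have const: "s (f (n + k)) = m" for k
      by (meson antisym)
    show thesis
    proof (rule that)
      show "strict_mono (\<lambda>k. f (n + k))"
        using f(1) by (auto simp: strict_mono_def)
      show "incseq (s \<circ> (\<lambda>k. f (n + k)))"
        by (simp add: const o_def)
    qed
  qed
qed

lemma incseq_subseq_family:
  fixes s :: "'a \<Rightarrow> nat \<Rightarrow> nat"
  assumes "finite F"
  obtains r :: "nat \<Rightarrow> nat" where "strict_mono r" "\<And>e. e \<in> F \<Longrightarrow> incseq (s e \<circ> r)"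
proof -
  from assms have "\<exists>r::nat \<Rightarrow> nat. strict_mono r \<and> (\<forall>e\<in>F. incseq (s e \<circ> r))"
  proof induction
    case empty
    then show ?case by (auto intro!: exI[of _ id] simp: strict_mono_def)
  next
    case (insert x F)
    then obtain r :: "nat \<Rightarrow> nat" where r: "strict_mono r" "\<forall>e\<in>F. incseq (s e \<circ> r)" by blast
    obtain r' where r': "strict_mono r'" "incseq ((s x \<circ> r) \<circ> r')"
      by (rule incseq_subseq_nat)
    have "incseq (s e \<circ> (r \<circ> r'))" if "e \<in> F" for e
      using r(2) that r'(1) by (auto simp: mono_def strict_mono_less_eq)
    moreover have "incseq (s x \<circ> (r \<circ> r'))"
      using r'(2) by (simp add: o_def)
    ultimately show ?case
      using strict_mono_o[OF r(1) r'(1)] by blast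
  qed
  then show thesis using that by blast
qed

text \<open>Multisets over the finite set \<open>F\<close> are vectors of multiplicities indexed by
  \<open>F\<close>, and inclusion is the coordinatewise order, so subsequences can be extracted one
  coordinate at a time.\<close>

lemma dickson_mset:
  fixes f :: "nat \<Rightarrow> 'a multiset"
  assumes "finite F" and "\<And>n. set_mset (f n) \<subseteq> F"
  shows "\<exists>r::nat \<Rightarrow> nat. strict_mono r \<and> (\<forall>i j. i \<le> j \<longrightarrow> f (r i) \<subseteq># f (r j))"
proof -
  obtain r where r: "strict_mono r" "\<And>e. e \<in> F \<Longrightarrow> incseq ((\<lambda>n. count (f n) e) \<circ> r)"
    using incseq_subseq_family[OF assms(1), of "\<lambda>e n. count (f n) e"] by blast
  have "f (r i) \<subseteq># f (r j)" if "i \<le> j" for i j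
  proof (rule mset_subset_eqI)
    fix e
    show "count (f (r i)) e \<le> count (f (r j)) e"
    proof (cases "e \<in> F")
      case True
      then show ?thesis using incseqD[OF r(2) that] by simp
    next
      case False
      then have "count (f (r i)) e = 0" using assms(2) by (meson not_in_iff subsetD)
      then show ?thesis by simp
    qed
  qed
  then show ?thesis using r(1) by blast
qed

section \<open>The compact-open topology on the dual\<close>

lemma norm_dual_app [simp]: "norm (dual_app \<phi> x) = 1"
  using dual_app[of \<phi>] by (simp add: is_character_def)

lemma continuous_dual_app: "continuous_on S (dual_app \<phi>)"
  using dual_app[of \<phi>] by (auto simp: is_character_def intro: continuous_on_subset)

text \<open>Uniform closeness on \<open>K\<close>. For compact \<open>K\<close> and \<epsilon> > 0
  these sets form a neighbourhood base at \<open>a\<close> of the compact-open topology, by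
  \<open>open_contains_dual_nbhd\<close> and \<open>dual_nbhd_contains_open\<close>.\<close>

definition dual_nbhd ::
    "'g::topological_ab_group_add dual \<Rightarrow> 'g set \<Rightarrow> real \<Rightarrow> 'g dual set" where
  "dual_nbhd a K \<epsilon> = {\<phi>. \<forall>x\<in>K. dist (dual_app \<phi> x) (dual_app a x) < \<epsilon>}"

lemma dual_nbhd_mono: "K \<subseteq> K' \<Longrightarrow> \<epsilon>' \<le> \<epsilon> \<Longrightarrow> dual_nbhd a K' \<epsilon>' \<subseteq> dual_nbhd a K \<epsilon>"
  by (fastforce simp: dual_nbhd_def)

text \<open>Induction on the generation of \<open>W\<close>: an intersection takes the union of the
  compact sets and the smaller radius; for a generator, the compact image of \<open>K\<close> has a
  uniform margin inside \<open>U\<close>.\<close>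

lemma open_contains_dual_nbhd:
  fixes W :: "'g::topological_ab_group_add dual set"
  assumes "open W" "a \<in> W"
  obtains K \<epsilon> where "compact K" "\<epsilon> > 0" "dual_nbhd a K \<epsilon> \<subseteq> W"
proof -
  have "generate_topology {{\<phi>. dual_app \<phi> ` K \<subseteq> U} | K U. compact (K::'g set) \<and> open U} W"
    using assms(1) by (simp add: open_dual_def)
  then have "\<forall>a\<in>W. \<exists>K \<epsilon>. compact K \<and> \<epsilon> > 0 \<and> dual_nbhd a K \<epsilon> \<subseteq> W"
  proof induction
    case UNIV
    then show ?case by (metis compact_empty subset_UNIV zero_less_one)
  next
    case (Int V W)
    show ?case
    proof
      fix a assume "a \<in> V \<inter> W"
      then obtain K \<epsilon> L \<delta> where "compact K" "\<epsilon> > 0" "dual_nbhd a K \<epsilon> \<subseteq> V"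
        and "compact L" "\<delta> > 0" "dual_nbhd a L \<delta> \<subseteq> W"
        using Int.IH by (metis IntD1 IntD2)
      moreover have "dual_nbhd a (K \<union> L) (min \<epsilon> \<delta>) \<subseteq> dual_nbhd a K \<epsilon>"
        "dual_nbhd a (K \<union> L) (min \<epsilon> \<delta>) \<subseteq> dual_nbhd a L \<delta>"
        by (rule dual_nbhd_mono; simp)+
      ultimately show "\<exists>K \<epsilon>. compact K \<and> \<epsilon> > 0 \<and> dual_nbhd a K \<epsilon> \<subseteq> V \<inter> W"
        by (intro exI[of _ "K \<union> L"] exI[of _ "min \<epsilon> \<delta>"]) auto
    qed
  next
    case (UN \<K>)
    then show ?case by (meson Union_iff Union_upper order_trans)
  next
    case (Basis W)
    then obtain K U where W: "W = {\<phi>. dual_app \<phi> ` K \<subseteq> U}" and K: "compact K" and U: "open U"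
      by blast
    show ?case
    proof
      fix a assume "a \<in> W"
      then have "dual_app a ` K \<subseteq> U" by (simp add: W)
      moreover have "compact (dual_app a ` K)"
        by (rule compact_continuous_image[OF continuous_dual_app K])
      ultimately obtain \<epsilon> where \<epsilon>: "\<epsilon> > 0" "(\<Union>z\<in>dual_app a ` K. ball z \<epsilon>) \<subseteq> U"
        using compact_subset_open_imp_ball_epsilon_subset[OF _ U] by blast
      have "dual_nbhd a K \<epsilon> \<subseteq> W"
        using \<epsilon>(2) by (fastforce simp: W dual_nbhd_def dist_commute)
      then show "\<exists>K \<epsilon>. compact K \<and> \<epsilon> > 0 \<and> dual_nbhd a K \<epsilon> \<subseteq> W"
        using K \<epsilon>(1) by blast
    qed
  qed
  then show thesis using assms(2) that by blast
qed

text \<open>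
  The compact set \<open>K\<close> is cut into finitely many compact pieces on each of which \<open>a\<close> is almost
  constant; on each piece a subbasic set forces \<open>\<phi>\<close> to be close to that constant.
\<close>

lemma dual_nbhd_contains_open:
  fixes K :: "'g::topological_ab_group_add set"
  assumes K: "compact K" and "\<epsilon> > 0"
  obtains V where "open V" "a \<in> V" "V \<subseteq> dual_nbhd a K \<epsilon>"
proof -
  \<comment> \<open>The pieces \<open>L c\<close> use closed balls of radius \<delta> to stay
    compact. The larger radius 2\<delta> lets \<open>a\<close> itself meet the strict bound, and the
    two radii add up to \<epsilon>.\<close>
  define \<delta> where "\<delta> = \<epsilon> / 3"
  have \<delta>: "\<delta> > 0" "3 * \<delta> = \<epsilon>" using \<open>\<epsilon> > 0\<close> by (simp_all add: \<delta>_def)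
  have im: "compact (dual_app a ` K)"
    by (rule compact_continuous_image[OF continuous_dual_app K])
  have cover: "dual_app a ` K \<subseteq> (\<Union>c. ball c \<delta>)"
    using centre_in_ball \<delta>(1) by blast
  obtain C where C: "finite C" "dual_app a ` K \<subseteq> (\<Union>c\<in>C. ball c \<delta>)"
    by (rule compactE_image[OF im open_ball cover])
  define L where "L c = K \<inter> dual_app a -` cball c \<delta>" for c
  define V where "V = (\<Inter>c\<in>C. {\<phi>. dual_app \<phi> ` L c \<subseteq> ball c (2 * \<delta>)})"
  have "compact (L c)" for c
    unfolding L_def using K
    by (intro compact_Int_closed closed_vimage closed_cball continuous_dual_app)
  then have "open {\<phi>. dual_app \<phi> ` L c \<subseteq> ball c (2 * \<delta>)}" for c
    unfolding open_dual_def by (intro generate_topology.Basis) auto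
  then have "open V"
    unfolding V_def using C(1) by blast
  moreover have "a \<in> V"
    using \<delta>(1) by (auto simp: V_def L_def)
  moreover have "V \<subseteq> dual_nbhd a K \<epsilon>"
  proof
    fix \<phi> assume \<phi>: "\<phi> \<in> V"
    have "dist (dual_app \<phi> x) (dual_app a x) < \<epsilon>" if "x \<in> K" for x
    proof -
      have "dual_app a x \<in> (\<Union>c\<in>C. ball c \<delta>)" using C(2) that by blast
      then obtain c where c: "c \<in> C" "dist c (dual_app a x) < \<delta>" by auto
      then have "x \<in> L c" using that by (simp add: L_def)
      then have "dist c (dual_app \<phi> x) < 2 * \<delta>"
        using \<phi> c(1) by (fastforce simp: V_def)
      then show ?thesis
        using c(2) dist_triangle3[of "dual_app \<phi> x" "dual_app a x" c] \<delta>(2) by linarith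
    qed
    then show "\<phi> \<in> dual_nbhd a K \<epsilon>" by (simp add: dual_nbhd_def)
  qed
  ultimately show thesis using that by blast
qed

section \<open>Closure, total boundedness and translation in terms of basic neighbourhoods\<close>

lemma closure_meets_dual_nbhd:
  assumes "a \<in> closure S" "compact K" "\<epsilon> > 0"
  obtains s where "s \<in> S" "s \<in> dual_nbhd a K \<epsilon>"
proof -
  obtain V where V: "open V" "a \<in> V" "V \<subseteq> dual_nbhd a K \<epsilon>"
    using dual_nbhd_contains_open[OF assms(2,3)] .
  have "S \<inter> V \<noteq> {}"
    using open_Int_closure_eq_empty[OF V(1), of S] assms(1) V(2) by blast
  then show thesis
    using V(3) that by blast
qed

text \<open>Stands in for convergent subsequences: among infinitely many points of \<open>A\<close>,
  infinitely many share one of these finitely many neighbourhoods.\<close>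

lemma compact_dual_totally_bounded:
  fixes A :: "'g::topological_ab_group_add dual set"
  assumes "compact A" "compact K" "\<epsilon> > 0"
  obtains C where "finite C" "A \<subseteq> (\<Union>a\<in>C. dual_nbhd a K \<epsilon>)"
proof -
  have "\<forall>a. \<exists>V. open V \<and> a \<in> V \<and> V \<subseteq> dual_nbhd a K \<epsilon>"
    using dual_nbhd_contains_open[OF assms(2,3)] by metis
  then obtain V where V: "\<And>a. open (V a)" "\<And>a. a \<in> V a" "\<And>a. V a \<subseteq> dual_nbhd a K \<epsilon>"
    by metis
  have cover: "A \<subseteq> (\<Union>a\<in>A. V a)"
    using V(2) by blast
  obtain C where C: "finite C" "A \<subseteq> (\<Union>a\<in>C. V a)"
    by (rule compactE_image[OF assms(1) V(1) cover])
  note C(2)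
  also have "(\<Union>a\<in>C. V a) \<subseteq> (\<Union>a\<in>C. dual_nbhd a K \<epsilon>)"
    by (intro UN_mono order_refl V(3))
  finally have "A \<subseteq> (\<Union>a\<in>C. dual_nbhd a K \<epsilon>)" .
  then show thesis by (rule that[OF C(1)])
qed

text \<open>Characters have modulus 1, so multiplying by \<psi>(x)^(-1) and c(x) preserves
  distances; what remains is the distance from \<phi>(x) to \<psi>(x), estimated through
  a(x).\<close>

lemma dual_nbhd_diff_add:
  assumes "\<phi> \<in> dual_nbhd a K (\<epsilon> / 2)" "\<psi> \<in> dual_nbhd a K (\<epsilon> / 2)"
  shows "\<phi> - \<psi> + c \<in> dual_nbhd c K \<epsilon>"
proof -
  have "dist (dual_app (\<phi> - \<psi> + c) x) (dual_app c x) < \<epsilon>" if "x \<in> K" for x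
  proof -
    let ?p = "dual_app \<phi> x" and ?q = "dual_app \<psi> x" and ?c = "dual_app c x"
    have "?q \<noteq> 0" using norm_dual_app[of \<psi> x] by (metis norm_zero zero_neq_one)
    moreover have "dual_app (\<phi> - \<psi> + c) x = ?p * inverse ?q * ?c"
      by (simp only: minus_dual_def plus_dual.rep_eq uminus_dual.rep_eq)
    ultimately have "dual_app (\<phi> - \<psi> + c) x - ?c = (?p - ?q) * inverse ?q * ?c"
      by (simp add: field_simps)
    then have "dist (dual_app (\<phi> - \<psi> + c) x) ?c = dist ?p ?q"
      by (simp add: dist_norm norm_mult norm_inverse)
    moreover have "dist ?p (dual_app a x) < \<epsilon> / 2" "dist ?q (dual_app a x) < \<epsilon> / 2"
      using assms that by (auto simp: dual_nbhd_def)
    ultimately show ?thesis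
      using dist_triangle2[of ?p ?q "dual_app a x"] by linarith
  qed
  then show ?thesis by (simp add: dual_nbhd_def)
qed

text \<open>One pair must serve all edges, because in
  \<open>finite_msets_with_sum_in_compact\<close> the edge is found only after \<open>K\<close> and
  \<epsilon> are fixed.\<close>

lemma uniform_dual_nbhd:
  assumes "finite F" and "\<And>e. e \<in> F \<Longrightarrow> open (W e)" and "\<And>e. e \<in> F \<Longrightarrow> a e \<in> W e"
  obtains K \<epsilon> where "compact K" "\<epsilon> > 0" "\<And>e. e \<in> F \<Longrightarrow> dual_nbhd (a e) K \<epsilon> \<subseteq> W e"
proof -
  from assms have "\<exists>K \<epsilon>. compact K \<and> \<epsilon> > 0 \<and> (\<forall>e\<in>F. dual_nbhd (a e) K \<epsilon> \<subseteq> W e)"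
  proof induction
    case empty
    show ?case by (intro exI[of _ "{}"] exI[of _ 1]) auto
  next
    case (insert e F)
    have "\<exists>K \<epsilon>. compact K \<and> \<epsilon> > 0 \<and> (\<forall>e\<in>F. dual_nbhd (a e) K \<epsilon> \<subseteq> W e)"
      by (rule insert.IH) (use insert.prems in auto)
    then obtain K \<epsilon> where K: "compact K" "\<epsilon> > 0" "\<forall>e\<in>F. dual_nbhd (a e) K \<epsilon> \<subseteq> W e"
      by blast
    obtain L \<delta> where L: "compact L" "\<delta> > 0" "dual_nbhd (a e) L \<delta> \<subseteq> W e"
      using open_contains_dual_nbhd[of "W e" "a e"] insert.prems by blast
    have "dual_nbhd b (K \<union> L) (min \<epsilon> \<delta>) \<subseteq> dual_nbhd b K \<epsilon>"
      "dual_nbhd b (K \<union> L) (min \<epsilon> \<delta>) \<subseteq> dual_nbhd b L \<delta>" for b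
      by (rule dual_nbhd_mono; simp)+
    then show ?case
      using K L by (intro exI[of _ "K \<union> L"] exI[of _ "min \<epsilon> \<delta>"]) fastforce
  qed
  then show thesis using that by blast
qed

section \<open>Countable neighbourhood bases and limits of sequences\<close>

lemma locally_compact_exhaustion:
  assumes "locally_compact_space (euclidean :: 'a::second_countable_topology topology)"
  obtains K :: "nat \<Rightarrow> 'a::second_countable_topology set"
    where "\<And>n. compact (K n)" "incseq K" "\<And>L. compact L \<Longrightarrow> \<exists>n. L \<subseteq> K n"
proof -
  \<comment> \<open>By the Lindelof property, countably many open sets with compact supersets
    \<open>C i\<close> cover the group. A compact \<open>L\<close> meets the need of only finitely
    many of them, hence lies in a finite union of the \<open>C i\<close>.\<close>
  define \<F> where "\<F> = {U::'a set. open U \<and> (\<exists>C. compact C \<and> U \<subseteq> C)}"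
  have cover: "\<Union>\<F> = UNIV"
    using assms by (fastforce simp: \<F>_def locally_compact_space_def)
  obtain \<F>' where \<F>': "\<F>' \<subseteq> \<F>" "countable \<F>'" "\<Union>\<F>' = UNIV"
    using Lindelof[of \<F>] cover by (metis (no_types, lifting) CollectD \<F>_def)
  then have "\<F>' \<noteq> {}" by auto
  define U where "U = from_nat_into \<F>'"
  have range: "range U = \<F>'"
    unfolding U_def using \<open>\<F>' \<noteq> {}\<close> \<F>'(2) by (rule range_from_nat_into)
  have "\<forall>n. \<exists>C. compact C \<and> U n \<subseteq> C"
    using range \<F>'(1) by (auto simp: \<F>_def)
  then obtain C where C: "\<And>n. compact (C n)" "\<And>n. U n \<subseteq> C n" by metis
  define K where "K n = (\<Union>i\<le>n. C i)" for n
  show thesis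
  proof (rule that)
    show "compact (K n)" for n
      unfolding K_def using C(1) by blast
    show "incseq K"
      unfolding K_def mono_def by (auto intro: order_trans)
    fix L :: "'a set" assume L: "compact L"
    have "open (U n)" for n
      using range \<F>'(1) by (auto simp: \<F>_def)
    moreover have "L \<subseteq> (\<Union>n. U n)"
      using range \<F>'(3) by simp
    ultimately obtain I where I: "finite I" "L \<subseteq> (\<Union>i\<in>I. U i)"
      using compactE_image[OF L, of UNIV U] by (metis UNIV_I)
    obtain n where "I \<subseteq> {..n}"
      using I(1) finite_nat_iff_bounded_le by blast
    then have "L \<subseteq> K n"
      using I(2) C(2) by (fastforce simp: K_def)
    then show "\<exists>n. L \<subseteq> K n" ..
  qed
qed

lemma dual_eqI:
  assumes "\<And>x. dual_app \<phi> x = dual_app \<psi> x"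
  shows "\<phi> = \<psi>"
  using assms by (simp add: dual_app_inject[symmetric] fun_eq_iff)

lemma closure_dual_if_finite_on_compacts:
  fixes a :: "'g::{topological_ab_group_add, second_countable_topology} dual"
  assumes "locally_compact_space (euclidean :: 'g topology)" and a: "a \<in> closure S"
    and fin: "\<And>A. compact A \<Longrightarrow> finite (S \<inter> A)"
  shows "a \<in> S"
proof -
  obtain K :: "nat \<Rightarrow> 'g set" where
    K: "\<And>n. compact (K n)" "incseq K" "\<And>L. compact L \<Longrightarrow> \<exists>n. L \<subseteq> K n"
    using locally_compact_exhaustion[OF assms(1)] by blast
  \<comment> \<open>Every compact set lies in some \<open>K n\<close>, so these countably many
    neighbourhoods form a base at \<open>a\<close>, and points chosen in them converge to
    \<open>a\<close>.\<close>
  have "\<forall>n. \<exists>s. s \<in> S \<and> s \<in> dual_nbhd a (K n) (inverse (real (Suc n)))"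
    using closure_meets_dual_nbhd[OF a K(1)] by (metis inverse_positive_iff_positive of_nat_0_less_iff zero_less_Suc)
  then obtain s where s: "\<And>n. s n \<in> S" "\<And>n. s n \<in> dual_nbhd a (K n) (inverse (real (Suc n)))"
    by metis
  have tail: "\<exists>N. \<forall>n\<ge>N. s n \<in> dual_nbhd a L \<epsilon>" if L: "compact L" and "\<epsilon> > 0" for L \<epsilon>
  proof -
    obtain m where m: "L \<subseteq> K m" using K(3)[OF L] by blast
    obtain k where k: "inverse (real (Suc k)) < \<epsilon>" using reals_Archimedean[OF \<open>\<epsilon> > 0\<close>] by blast
    have "s n \<in> dual_nbhd a L \<epsilon>" if n: "n \<ge> max m k" for n
    proof -
      have "L \<subseteq> K n" using m n incseqD[OF K(2), of m n] by auto
      moreover have "inverse (real (Suc n)) \<le> inverse (real (Suc k))"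
        using n by (intro le_imp_inverse_le) auto
      with k have "inverse (real (Suc n)) \<le> \<epsilon>" by linarith
      ultimately show ?thesis
        using s(2) dual_nbhd_mono by blast
    qed
    then show ?thesis by blast
  qed
  have lim: "s \<longlonglongrightarrow> a"
  proof (rule topological_tendstoI)
    fix W assume "open W" "a \<in> W"
    then obtain L \<epsilon> where "compact L" "\<epsilon> > 0" "dual_nbhd a L \<epsilon> \<subseteq> W"
      using open_contains_dual_nbhd by blast
    then show "\<forall>\<^sub>F n in sequentially. s n \<in> W"
      using tail[of L \<epsilon>] by (auto simp: eventually_sequentially)
  qed
  have "compact (insert a (range s))"
  proof (rule compactI)
    fix \<C> assume \<C>: "\<forall>T\<in>\<C>. open T" "insert a (range s) \<subseteq> \<Union>\<C>"
    \<comment> \<open>A member of the cover containing \<open>a\<close> absorbs a tail of the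
      sequence; finitely many more catch the remaining terms.\<close>
    then obtain T where T: "T \<in> \<C>" "a \<in> T" by blast
    then obtain N where N: "\<And>n. n \<ge> N \<Longrightarrow> s n \<in> T"
      using lim \<C>(1) by (metis eventually_sequentially topological_tendstoD)
    have "\<forall>n. \<exists>B. B \<in> \<C> \<and> s n \<in> B"
      using \<C>(2) by blast
    then obtain B where B: "\<And>n. B n \<in> \<C>" "\<And>n. s n \<in> B n" by metis
    have "s n \<in> \<Union>(insert T (B ` {..<N}))" for n
      using N[of n] B(2)[of n] by (cases "n < N") auto
    then show "\<exists>\<D>\<subseteq>\<C>. finite \<D> \<and> insert a (range s) \<subseteq> \<Union>\<D>"
      using T B(1) by (intro exI[of _ "insert T (B ` {..<N})"]) auto
  qed
  then have "finite (S \<inter> insert a (range s))" by (rule fin)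
  then have "finite (range s)"
    by (rule rev_finite_subset) (use s(1) in auto)
  \<comment> \<open>A value attained infinitely often lies in every basic neighbourhood of
    \<open>a\<close>; taking the compact sets \<open>{x}\<close> below forces it to equal
    \<open>a\<close>.\<close>
  then obtain m where m: "infinite {n. s n = s m}"
    using pigeonhole_infinite[of "UNIV :: nat set" s] by auto
  have "s m = a"
  proof (rule dual_eqI, rule ccontr)
    fix x assume neq: "dual_app (s m) x \<noteq> dual_app a x"
    define d where "d = dist (dual_app (s m) x) (dual_app a x)"
    have "d > 0" using neq by (simp add: d_def)
    then obtain N where N: "\<And>n. n \<ge> N \<Longrightarrow> s n \<in> dual_nbhd a {x} d"
      using tail[of "{x}" d] by auto
    obtain n where "n \<ge> N" "s n = s m"
      using m by (auto simp: infinite_nat_iff_unbounded_le)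
    then have "s m \<in> dual_nbhd a {x} d" using N by metis
    then show False by (simp add: dual_nbhd_def d_def)
  qed
  then show "a \<in> S" using s(1) by metis
qed

section \<open>Finitely generated submonoids of the dual\<close>

lemma finite_msets_with_sum_in_compact:
  fixes w :: "'e \<Rightarrow> 'g::topological_ab_group_add dual"
  assumes F: "finite F" and A: "compact A"
    and sep: "\<And>e. e \<in> F \<Longrightarrow> - w e \<notin> closure {\<Sum>e\<in>#M. w e | M. set_mset M \<subseteq> F}"
  shows "finite {M. set_mset M \<subseteq> F \<and> (\<Sum>e\<in>#M. w e) \<in> A}"
proof (rule ccontr)
  define S where "S = {\<Sum>e\<in>#M. w e | M. set_mset M \<subseteq> F}"
  obtain K \<epsilon> where K: "compact K" "\<epsilon> > 0" "\<And>e. e \<in> F \<Longrightarrow> dual_nbhd (- w e) K \<epsilon> \<subseteq> - closure S"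
    using uniform_dual_nbhd[OF F, of "\<lambda>_. - closure S" "\<lambda>e. - w e"] sep S_def
      open_Compl[OF closed_closure] by (metis (no_types, lifting) ComplI)
  obtain C where C: "finite C" "A \<subseteq> (\<Union>a\<in>C. dual_nbhd a K (\<epsilon> / 2))"
    using compact_dual_totally_bounded[OF A K(1), of "\<epsilon> / 2"] K(2) by auto
  assume "infinite {M. set_mset M \<subseteq> F \<and> (\<Sum>e\<in>#M. w e) \<in> A}"
  \<comment> \<open>Injectivity makes the inclusions from Dickson's lemma strict, so that
    \<open>D\<close> below is nonempty.\<close>
  then obtain f :: "nat \<Rightarrow> 'e multiset" where inj: "inj f"
    and f: "range f \<subseteq> {M. set_mset M \<subseteq> F \<and> (\<Sum>e\<in>#M. w e) \<in> A}"
    using infinite_countable_subset by blast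
  have fF: "set_mset (f n) \<subseteq> F" for n
    using f by auto
  obtain r :: "nat \<Rightarrow> nat" where r: "strict_mono r" "\<forall>i j. i \<le> j \<longrightarrow> f (r i) \<subseteq># f (r j)"
    using dickson_mset[of F f, OF F fF] by (elim exE conjE)
  define x where "x n = (\<Sum>e\<in>#f (r n). w e)" for n
  have "x n \<in> A" for n
    using f by (auto simp: x_def)
  then have "\<forall>n\<in>UNIV. \<exists>a\<in>C. x n \<in> dual_nbhd a K (\<epsilon> / 2)"
    using C(2) by blast
  then obtain a where "infinite {n. x n \<in> dual_nbhd a K (\<epsilon> / 2)}"
    using pigeonhole_infinite_rel[OF infinite_UNIV_nat C(1),
      of "\<lambda>n a. x n \<in> dual_nbhd a K (\<epsilon> / 2)"] by auto
  then obtain i j where ij: "i < j" "x i \<in> dual_nbhd a K (\<epsilon> / 2)" "x j \<in> dual_nbhd a K (\<epsilon> / 2)"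
    unfolding infinite_nat_iff_unbounded by blast
  define D where "D = f (r j) - f (r i)"
  have D: "f (r j) = f (r i) + D"
    using r(2)[rule_format, of i j] ij(1) by (simp add: D_def)
  have "f (r i) \<noteq> f (r j)"
    using inj r(1) ij(1) by (metis injD nat_neq_iff strict_mono_less)
  then have "D \<noteq> {#}" using D by auto
  then obtain e D' where D': "D = add_mset e D'" using multiset_cases by blast
  have "set_mset D \<subseteq> F" using fF[of "r j"] D by simp
  then have e: "e \<in> F" and "set_mset D' \<subseteq> F" by (simp_all add: D')
  \<comment> \<open>Removing one copy of \<open>e\<close> from \<open>D\<close> leaves a multiset
    over \<open>F\<close>, so this element near \<open>- w e\<close> is still a sum in
    \<open>S\<close>.\<close>
  moreover have "x j - x i + - w e = (\<Sum>e\<in>#D'. w e)"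
    by (simp add: x_def D D')
  ultimately have "x j - x i + - w e \<in> S" unfolding S_def by blast
  then have "x j - x i + - w e \<in> closure S" using closure_subset by blast
  moreover have "x j - x i + - w e \<in> dual_nbhd (- w e) K \<epsilon>"
    by (rule dual_nbhd_diff_add[OF ij(3,2)])
  ultimately show False using K(3)[OF e] by blast
qed

text \<open>A multiset has finitely many orderings. This carries finiteness from multisets of edges
  back to paths.\<close>

lemma finite_lists_of_msets:
  assumes "finite X"
  shows "finite {xs. mset xs \<in> X}"
proof -
  have "finite {xs. mset xs = M}" for M :: "'a multiset"
    using mset_eq_finite ex_mset by metis
  then have "finite (\<Union>M\<in>X. {xs. mset xs = M})" using assms by blast
  also have "(\<Union>M\<in>X. {xs. mset xs = M}) = {xs. mset xs \<in> X}" by blast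
  finally show ?thesis .
qed

section \<open>Paths in a bouquet of loops\<close>

text \<open>Loops at \<open>v\<close> compose in any order. Vertices other than \<open>v\<close> may
  exist but carry only their path of length 0, hence the disjunction.\<close>

lemma paths_bouquet:
  assumes "v \<in> verts E" and "\<forall>e\<in>arcs E. head E e = v \<and> tail E e = v"
  shows "(u, p) \<in> paths E \<longleftrightarrow> u \<in> verts E \<and> set p \<subseteq> arcs E \<and> (p = [] \<or> u = v)"
proof -
  have cas: "pre_digraph.cas E v p v" if "set p \<subseteq> arcs E" for p
    using that assms(2) by (induction p) (auto simp: pre_digraph.cas.simps)
  show ?thesis
  proof (cases p)
    case Nil
    then show ?thesis
      by (auto simp: paths_def paths_of_length_def pre_digraph.awalk_def pre_digraph.cas.simps)
  next
    case (Cons e q)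
    then show ?thesis using cas[of p] cas[of q] assms
      by (auto simp: paths_def paths_of_length_def pre_digraph.awalk_def pre_digraph.cas.simps)
  qed
qed

lemma labelling_map_bouquet:
  assumes "v \<in> verts E" and "\<forall>e\<in>arcs E. head E e = v \<and> tail E e = v"
    and "labelling_map E \<omega>" and "(u, p) \<in> paths E"
  shows "\<omega> (u, p) = (\<Sum>e\<in>#mset p. \<omega> (edge_path E e))"
proof (cases "p = []")
  case True
  then show ?thesis
    using assms paths_bouquet[OF assms(1,2), of u p] by (simp add: labelling_map_def)
next
  case False
  then have "\<omega> (u, p) = (\<Sum>e\<leftarrow>p. \<omega> (edge_path E e))"
    using assms(3,4) unfolding labelling_map_def by blast
  then show ?thesis by (simp add: sum_mset_sum_list flip: mset_map)
qed

text \<open>Brings the label set into the form used in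
  \<open>finite_msets_with_sum_in_compact\<close>; each multiset is realised by ordering its edges
  into a path at \<open>v\<close>.\<close>

lemma image_paths_bouquet:
  assumes "v \<in> verts E" and "\<forall>e\<in>arcs E. head E e = v \<and> tail E e = v"
    and "labelling_map E \<omega>"
  shows "\<omega> ` paths E = {\<Sum>e\<in>#M. \<omega> (edge_path E e) | M. set_mset M \<subseteq> arcs E}"
proof (intro equalityI subsetI)
  fix y assume "y \<in> \<omega> ` paths E"
  then obtain u p where "(u, p) \<in> paths E" "y = \<omega> (u, p)" by auto
  then show "y \<in> {\<Sum>e\<in>#M. \<omega> (edge_path E e) | M. set_mset M \<subseteq> arcs E}"
    using labelling_map_bouquet[OF assms] paths_bouquet[OF assms(1,2)]
    by (auto intro!: exI[of _ "mset p"])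
next
  fix y assume "y \<in> {\<Sum>e\<in>#M. \<omega> (edge_path E e) | M. set_mset M \<subseteq> arcs E}"
  then obtain M where "set_mset M \<subseteq> arcs E" "y = (\<Sum>e\<in>#M. \<omega> (edge_path E e))"
    by blast
  then obtain p where p: "set p \<subseteq> arcs E" "y = (\<Sum>e\<in>#mset p. \<omega> (edge_path E e))"
    by (metis ex_mset set_mset_mset)
  then have "(v, p) \<in> paths E" using paths_bouquet[OF assms(1,2)] assms(1) by blast
  then show "y \<in> \<omega> ` paths E"
    using labelling_map_bouquet[OF assms] p(2) by (metis image_eqI)
qed

theorem proposition2p6:
  fixes E :: "('v, 'e) pre_digraph"
    and \<omega> :: "'v \<times> 'e list \<Rightarrow>
      'g::{topological_ab_group_add, t2_space, second_countable_topology} dual"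
  assumes "fin_digraph E"
    and "\<exists>v\<in>verts E. \<forall>e\<in>arcs E. head E e = v \<and> tail E e = v"
    and "locally_compact_space (euclidean :: 'g topology)"
    and "labelling_map E \<omega>"
  shows "(\<forall>e\<in>arcs E. - \<omega> (edge_path E e) \<notin> closure (\<omega> ` paths E)) \<longleftrightarrow>
    almost_proper E \<omega>"
proof -
  have fin: "finite (verts E)" "finite (arcs E)"
    using fin_digraph.finite_verts[OF assms(1)] fin_digraph.finite_arcs[OF assms(1)] .
  obtain v where v: "v \<in> verts E" "\<forall>e\<in>arcs E. head E e = v \<and> tail E e = v"
    using assms(2) by blast
  note pb = paths_bouquet[OF v] and lb = labelling_map_bouquet[OF v assms(4)]
    and ib = image_paths_bouquet[OF v assms(4)]
  show ?thesis
  proof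
    assume sep: "\<forall>e\<in>arcs E. - \<omega> (edge_path E e) \<notin> closure (\<omega> ` paths E)"
    show "almost_proper E \<omega>"
      unfolding almost_proper_def
    proof (intro allI impI)
      fix A :: "'g dual set" assume "compact A"
      then have "finite {M. set_mset M \<subseteq> arcs E \<and> (\<Sum>e\<in>#M. \<omega> (edge_path E e)) \<in> A}"
        using sep fin(2) unfolding ib by (intro finite_msets_with_sum_in_compact) auto
      then have "finite (verts E \<times>
          {p. mset p \<in> {M. set_mset M \<subseteq> arcs E \<and> (\<Sum>e\<in>#M. \<omega> (edge_path E e)) \<in> A}})"
        using fin(1) by (blast intro: finite_lists_of_msets)
      then show "finite ({\<mu> \<in> paths E. \<omega> \<mu> \<in> A} - paths_of_length E 0)"
        by (rule rev_finite_subset) (auto simp: pb lb)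
    qed
  next
    assume ap: "almost_proper E \<omega>"
    show "\<forall>e\<in>arcs E. - \<omega> (edge_path E e) \<notin> closure (\<omega> ` paths E)"
    proof (intro ballI notI)
      fix e assume e: "e \<in> arcs E" and cl: "- \<omega> (edge_path E e) \<in> closure (\<omega> ` paths E)"
      \<comment> \<open>The paths of length 0, which almost properness leaves out, contribute only
        the label 0.\<close>
      have "finite (\<omega> ` paths E \<inter> A)" if "compact A" for A
      proof -
        have "finite (\<omega> ` ({\<mu> \<in> paths E. \<omega> \<mu> \<in> A} - paths_of_length E 0) \<union> {0})"
          using ap that by (simp add: almost_proper_def)
        moreover have "\<omega> \<mu> = 0" if "\<mu> \<in> paths_of_length E 0" for \<mu>
          using that assms(4)
          by (auto simp: paths_of_length_def labelling_map_def pre_digraph.awalk_def)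
        ultimately show ?thesis
          by (elim rev_finite_subset) auto
      qed
      then have "- \<omega> (edge_path E e) \<in> \<omega> ` paths E"
        using closure_dual_if_finite_on_compacts[OF assms(3) cl] by blast
      then obtain u p where up: "(u, p) \<in> paths E" "- \<omega> (edge_path E e) = \<omega> (u, p)"
        by auto
      then have p: "set p \<subseteq> arcs E"
        "- \<omega> (edge_path E e) = (\<Sum>e\<in>#mset p. \<omega> (edge_path E e))"
        using pb lb[OF up(1)] by auto
      \<comment> \<open>The word \<open>e # p\<close> has label 0, and so have its powers. They are
        based at \<open>v\<close>, as \<open>u\<close> may be another vertex when \<open>p\<close>
        is empty; \<open>Suc n\<close> keeps them of positive length.\<close>
      define q where "q n = concat (replicate (Suc n) (e # p))" for n
      have zero: "(\<Sum>e\<in>#mset (concat (replicate n (e # p))). \<omega> (edge_path E e)) = 0" for n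
        by (induction n) (simp_all flip: p(2))
      have "set (q n) \<subseteq> arcs E" for n
        using e p(1) by (auto simp: q_def)
      then have path: "(v, q n) \<in> paths E" for n
        using v(1) by (simp add: pb)
      have "(v, q n) \<in> {\<mu> \<in> paths E. \<omega> \<mu> \<in> {0}} - paths_of_length E 0" for n
        using path[of n] zero[of "Suc n"] lb[OF path[of n]]
        by (simp add: q_def paths_of_length_def)
      then have "range (\<lambda>n. (v, q n)) \<subseteq> {\<mu> \<in> paths E. \<omega> \<mu> \<in> {0}} - paths_of_length E 0"
        by blast
      moreover have "inj (\<lambda>n. (v, q n))"
      proof (rule injI)
        fix m n assume "(v, q m) = (v, q n)"
        \<comment> \<open>Distinct powers have distinct lengths, since \<open>e # p\<close> is
          nonempty.\<close>
        moreover have "length (q k) = Suc k * Suc (length p)" for k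
          by (simp add: q_def length_concat sum_list_replicate del: replicate_Suc)
        ultimately have "Suc m * Suc (length p) = Suc n * Suc (length p)" by (metis prod.inject)
        then show "m = n" by (metis mult_cancel2 nat.inject nat.distinct(1))
      qed
      ultimately have "infinite ({\<mu> \<in> paths E. \<omega> \<mu> \<in> {0}} - paths_of_length E 0)"
        using finite_subset range_inj_infinite by blast
      then show False
        using ap[unfolded almost_proper_def, rule_format, OF compact_sing[of 0]] by contradiction
    qed
  qed
qed

end
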